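(* Let $m,n \in \mathbb{N}$ with $n \geq m$. Then, as $k \to \infty$ ($k\in\mathbb{N}$), $$\omega\binom{nk}{mk} = \sum_{j=1}^{\infty}\left(\pi\left(\frac{nk}{j}\right) - \pi\left(\frac{(n-m)k}{j}\right) - \pi\left(\frac{mk}{j}\right)\right) + O(\sqrt{k}),$$ where the implied constant may depend on $n$ and $m$.
   Context: $\mathbb{N}=\{1,2,3,\dots\}$. For $x\in\mathbb{R}$, $\pi(x)$ is the number of primes $p\le x$ (so $\pi(x)=0$ for $x<2$ and the sum over $j$ is finite for each $k$). For $N\in\mathbb{N}$, $\omega(N)$ is the number of distinct primes dividing $N$, and $\omega\binom{a}{b}$ means $\omega\left(\binom{a}{b}\right)$. *)

theory Defs
  imports Complex_Main "HOL-Library.Landau_Symbols" "HOL-Computational_Algebra.Primes"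
begin

definition primes_pi :: "real \<Rightarrow> nat" where
  "primes_pi x = card {p :: nat. prime p \<and> real p \<le> x}"

definition omega :: "nat \<Rightarrow> nat" where
  "omega N = card (prime_factors N)"

(* The set in primes_pi is finite, so its cardinality is the intended count. *)
lemma finite_primes_le: "finite {p :: nat. prime p \<and> real p \<le> x}"
proof (rule finite_subset)
  show "{p :: nat. prime p \<and> real p \<le> x} \<subseteq> {..nat \<lfloor>x\<rfloor>}"
    by (auto simp: le_nat_iff le_floor_iff)
qed simp

lemma primes_pi_eq_0: "x < 2 \<Longrightarrow> primes_pi x = 0"
proof -
  assume x: "x < 2"
  have "\<not> real p \<le> x" if "prime p" for p :: nat
    using prime_ge_2_nat[OF that] x by linarith
  then have "{p :: nat. prime p \<and> real p \<le> x} = {}"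
    by blast
  then show ?thesis
    by (simp only: primes_pi_def card.empty)
qed

(* Only finitely many j contribute to a sum of values primes_pi (x / j), so the series
   over j is a finite sum and suminf is not evaluated outside its domain. *)
lemma summable_primes_pi_div: "summable (\<lambda>j. real (primes_pi (x / real (Suc j))))"
proof (rule summable_finite)
  show "finite {..nat \<lceil>\<bar>x\<bar>\<rceil>}" by simp
next
  fix j assume "j \<notin> {..nat \<lceil>\<bar>x\<bar>\<rceil>}"
  then have "\<bar>x\<bar> \<le> real j" by (simp add: not_le) linarith
  then have "x < 2 * real (Suc j)" by simp
  then have "x / real (Suc j) < 2" by (simp add: field_simps)
  then show "real (primes_pi (x / real (Suc j))) = 0"
    by (simp add: primes_pi_eq_0)
qed

end

theory Submission imports Defs begin

text \<open>
  Counting pairs \<open>(p, j)\<close> with \<open>p * j \<le> N\<close> in two ways turns the sum over \<open>j\<close> of \<open>\<pi>(N / j)\<close>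
  into the sum over primes of \<open>\<lfloor>N / p\<rfloor>\<close>.  Hence the series is the sum over primes
  \<open>p \<le> nk\<close> of \<open>d(p) = \<lfloor>nk / p\<rfloor> - \<lfloor>(n - m)k / p\<rfloor> - \<lfloor>mk / p\<rfloor>\<close>, and always \<open>d(p) \<in> {0, 1}\<close>.
  If \<open>p\<^sup>2 > nk\<close>, then by Legendre's formula \<open>d(p)\<close> is the exponent of \<open>p\<close> in the binomial
  coefficient, so it is the indicator of \<open>p\<close> dividing it.  The remaining primes number at most
  \<open>sqrt (nk)\<close>, and each contributes an error of at most 1.
\<close>

text \<open>The inner count of the double counting: the multiples \<open>p * 1, p * 2, ...\<close>
  up to \<open>N\<close>, with \<open>j\<close> shifted by one to start at 0.\<close>

lemma card_Suc_mult_le: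
  assumes "p > 0" "N \<le> M"
  shows "card {j\<in>{..<M}. p * Suc j \<le> N} = N div p"
proof -
  have "{j\<in>{..<M}. p * Suc j \<le> N} = {..<N div p}"
  proof (intro set_eqI iffI)
    fix j assume "j \<in> {j\<in>{..<M}. p * Suc j \<le> N}"
    then show "j \<in> {..<N div p}"
      using assms by (simp add: less_eq_div_iff_mult_less_eq Suc_le_eq[symmetric] mult.commute del: mult_Suc_right mult_Suc)
  next
    fix j assume "j \<in> {..<N div p}"
    moreover from this have "Suc j * p \<le> N"
      using assms by (simp add: less_eq_div_iff_mult_less_eq Suc_le_eq[symmetric] del: mult_Suc_right mult_Suc)
    moreover have "N div p \<le> M" using assms(2) div_le_dividend[of N p] by linarith
    ultimately show "j \<in> {j\<in>{..<M}. p * Suc j \<le> N}" by (simp add: mult.commute)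
  qed
  then show ?thesis by simp
qed

text \<open>The cutoff \<open>M\<close> is kept apart from \<open>N\<close> so that the series for
  \<open>a + b\<close>, \<open>a\<close> and \<open>b\<close> can later run over one common set of
  primes.\<close>

lemma primes_pi_divide_Suc:
  assumes "N \<le> M"
  shows "primes_pi (real N / real (Suc j)) = (\<Sum>p | prime p \<and> p \<le> M. of_bool (p * Suc j \<le> N))"
proof -
  have iff: "real p \<le> real N / real (Suc j) \<longleftrightarrow> p * Suc j \<le> N" for p
    by (simp only: pos_le_divide_eq of_nat_0_less_iff zero_less_Suc of_nat_mult[symmetric] of_nat_le_iff)
  have "p \<le> M" if "p * Suc j \<le> N" for p
    using that assms by (simp add: algebra_simps)
  then have "{p. prime p \<and> real p \<le> real N / real (Suc j)} = {p. prime p \<and> p \<le> M} \<inter> {p. p * Suc j \<le> N}"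
    unfolding iff by blast
  then show ?thesis
    unfolding primes_pi_def by (simp add: sum.If_cases of_bool_def)
qed

lemma suminf_primes_pi_divide:
  assumes "N \<le> M"
  shows "(\<Sum>j. real (primes_pi (real N / real (Suc j)))) = (\<Sum>p | prime p \<and> p \<le> M. real (N div p))"
proof -
  have "real (primes_pi (real N / real (Suc j))) = 0" if "j \<notin> {..<M}" for j
  proof -
    \<comment> \<open>Here \<open>j \<ge> M \<ge> N\<close>, so the quotient is even below
      1.\<close>
    have "real N / real (Suc j) < 2"
      using that assms by (simp add: divide_less_eq)
    then show ?thesis by (simp add: primes_pi_eq_0)
  qed
  then have "(\<Sum>j. real (primes_pi (real N / real (Suc j)))) = (\<Sum>j<M. real (primes_pi (real N / real (Suc j))))"
    by (intro suminf_finite) auto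
  also have "\<dots> = real (\<Sum>j<M. \<Sum>p | prime p \<and> p \<le> M. of_bool (p * Suc j \<le> N))"
    by (simp only: primes_pi_divide_Suc[OF assms] of_nat_sum)
  also have "(\<Sum>j<M. \<Sum>p | prime p \<and> p \<le> M. of_bool (p * Suc j \<le> N))
      = (\<Sum>p | prime p \<and> p \<le> M. \<Sum>j<M. of_bool (p * Suc j \<le> N) :: nat)"
    by (rule sum.swap)
  also have "\<dots> = (\<Sum>p | prime p \<and> p \<le> M. N div p)"
  proof (rule sum.cong)
    fix p assume "p \<in> {p. prime p \<and> p \<le> M}"
    then have "card {j\<in>{..<M}. p * Suc j \<le> N} = N div p"
      using assms by (intro card_Suc_mult_le) (auto simp: prime_gt_0_nat)
    moreover have "{j\<in>{..<M}. p * Suc j \<le> N} = {..<M} \<inter> {j. p * Suc j \<le> N}" by blast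
    ultimately show "(\<Sum>j<M. of_bool (p * Suc j \<le> N)) = N div p"
      by (simp add: sum.If_cases of_bool_def)
  qed simp
  finally show ?thesis by simp
qed

text \<open>Only the first term of Legendre's formula survives: no factor of \<open>fact N\<close>
  is divisible by \<open>p ^ 2\<close>, so each multiple of \<open>p\<close> contributes exactly
  one.\<close>

lemma multiplicity_fact_small:
  fixes p :: nat
  assumes "prime p" "N < p ^ 2"
  shows "multiplicity p (fact N :: nat) = N div p"
  using assms(2)
proof (induction N)
  case 0
  then show ?case by simp
next
  case (Suc N)
  have "multiplicity p (Suc N) = of_bool (p dvd Suc N)"
  proof (cases "p dvd Suc N")
    case True
    have "\<not> p ^ 2 dvd Suc N" using Suc.prems by (auto dest: dvd_imp_le)
    with True show ?thesis by (simp add: multiplicity_eqI[of p 1] power2_eq_square)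
  qed (simp add: not_dvd_imp_multiplicity_0)
  moreover have "multiplicity p (fact (Suc N) :: nat) = multiplicity p (Suc N) + multiplicity p (fact N :: nat)"
    unfolding fact_Suc of_nat_id
    using assms(1) by (intro prime_elem_multiplicity_mult_distrib) auto
  ultimately show ?case using Suc by (simp add: div_Suc dvd_eq_mod_eq_0)
qed

text \<open>The right-hand side is the carry out of the lowest digit when \<open>a\<close> and
  \<open>b\<close> are added in base \<open>p\<close>, the single carry left in Kummer's theorem
  when \<open>a + b < p ^ 2\<close>.\<close>

lemma multiplicity_binomial_small:
  fixes p :: nat
  assumes "prime p" "a + b < p ^ 2"
  shows "multiplicity p ((a + b) choose b) = (a mod p + b mod p) div p"
proof -
  have "fact b * fact a * ((a + b) choose b) = (fact (a + b) :: nat)"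
    using binomial_fact_lemma[of b "a + b"] by simp
  then have "multiplicity p (fact (a + b) :: nat) = multiplicity p (fact b * fact a * ((a + b) choose b))"
    by simp
  also have "\<dots> = multiplicity p (fact b :: nat) + multiplicity p (fact a :: nat) + multiplicity p ((a + b) choose b)"
    using assms(1) by (simp add: prime_elem_multiplicity_mult_distrib)
  finally show ?thesis
    using assms by (simp add: multiplicity_fact_small div_add1_eq[of a b p])
qed

text \<open>The binomial coefficient divides \<open>fact (a + b)\<close>, whose prime divisors are
  at most \<open>a + b\<close>.\<close>

lemma omega_binomial:
  "omega ((a + b) choose b) = (\<Sum>p | prime p \<and> p \<le> a + b. of_bool (p dvd ((a + b) choose b)))"
proof -
  have "p \<le> a + b" if "prime p" "p dvd ((a + b) choose b)" for p
  proof -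
    have "((a + b) choose b) dvd (fact (a + b) :: nat)"
      using binomial_fact_lemma[of b "a + b"] by (metis dvd_triv_right le_add2)
    then show ?thesis using that by (metis dvd_trans prime_dvd_fact_iff)
  qed
  then have "prime_factors ((a + b) choose b) = {p. prime p \<and> p \<le> a + b} \<inter> {p. p dvd ((a + b) choose b)}"
    by (auto simp: prime_factors_dvd)
  then show ?thesis
    unfolding omega_def by (simp add: sum.If_cases of_bool_def)
qed

lemma card_primes_square_le: "real (card {p :: nat. prime p \<and> p ^ 2 \<le> N}) \<le> sqrt (real N)"
proof -
  have "{p :: nat. prime p \<and> p ^ 2 \<le> N} \<subseteq> {0<..nat \<lfloor>sqrt (real N)\<rfloor>}"
  proof
    fix p assume p: "p \<in> {p :: nat. prime p \<and> p ^ 2 \<le> N}"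
    then have "real p ^ 2 \<le> real N" by (metis mem_Collect_eq of_nat_le_iff of_nat_power)
    then have "real p \<le> sqrt (real N)" by (rule real_le_rsqrt)
    then show "p \<in> {0<..nat \<lfloor>sqrt (real N)\<rfloor>}"
      using p by (simp add: prime_gt_0_nat le_nat_floor)
  qed
  then have "card {p :: nat. prime p \<and> p ^ 2 \<le> N} \<le> nat \<lfloor>sqrt (real N)\<rfloor>"
    using card_mono[of "{0<..nat \<lfloor>sqrt (real N)\<rfloor>}"] by simp
  then show ?thesis by (simp add: le_nat_iff le_floor_iff)
qed

lemma omega_binomial_bound:
  "\<bar>real (omega ((a + b) choose b)) -
      (\<Sum>j. real (primes_pi (real (a + b) / real (Suc j)))
           - real (primes_pi (real a / real (Suc j)))
           - real (primes_pi (real b / real (Suc j))))\<bar> \<le> sqrt (real (a + b))"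
proof -
  define N where "N = a + b"
  define P where "P = {p :: nat. prime p \<and> p \<le> N}"
  define C where "C = (a + b) choose b"
  \<comment> \<open>This is \<open>d(p)\<close> of the overview, written as a carry: no truncated
    subtraction occurs, and the bound by 1 follows from the size of the remainders.\<close>
  define e where "e p = (a mod p + b mod p) div p" for p :: nat
  have [simp]: "finite P" unfolding P_def by simp
  have "(\<Sum>j. real (primes_pi (real N / real (Suc j))) - real (primes_pi (real a / real (Suc j)))
           - real (primes_pi (real b / real (Suc j))))
      = (\<Sum>j. real (primes_pi (real N / real (Suc j)))) - (\<Sum>j. real (primes_pi (real a / real (Suc j))))
           - (\<Sum>j. real (primes_pi (real b / real (Suc j))))"
    by (simp only: suminf_diff summable_diff summable_primes_pi_div)
  also have "\<dots> = (\<Sum>p\<in>P. real (N div p) - real (a div p) - real (b div p))"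
    unfolding P_def N_def sum_subtractf
    by (simp only: suminf_primes_pi_divide[of _ "a + b"] le_add1 le_add2 order_refl)
  also have "\<dots> = (\<Sum>p\<in>P. real (e p))"
    by (simp add: e_def N_def div_add1_eq[of a b])
  finally have series: "(\<Sum>j. real (primes_pi (real N / real (Suc j)))
      - real (primes_pi (real a / real (Suc j))) - real (primes_pi (real b / real (Suc j))))
      = (\<Sum>p\<in>P. real (e p))" .
  have e_le: "e p \<le> 1" if "p \<in> P" for p
  proof -
    have "p > 0" using that by (simp add: P_def prime_gt_0_nat)
    then have "a mod p < p" "b mod p < p" by simp_all
    then have "a mod p + b mod p < 2 * p" by linarith
    then have "e p < 2" unfolding e_def by (rule less_mult_imp_div_less)
    then show ?thesis by simp
  qed
  \<comment> \<open>For \<open>p ^ 2 \<le> N\<close> both terms on the left lie in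
    \<open>{0, 1}\<close>; otherwise they coincide.\<close>
  have err: "\<bar>of_bool (p dvd C) - real (e p)\<bar> \<le> of_bool (p ^ 2 \<le> N)" if "p \<in> P" for p
  proof (cases "p ^ 2 \<le> N")
    case False
    have "prime p" using that by (simp add: P_def)
    have "multiplicity p C = e p"
      using \<open>prime p\<close> False unfolding C_def e_def N_def by (intro multiplicity_binomial_small) auto
    \<comment> \<open>Needed because \<open>multiplicity p 0\<close> is 0 by convention although
      \<open>p\<close> divides 0.\<close>
    moreover have "C \<noteq> 0" by (simp add: C_def)
    ultimately have "p dvd C \<longleftrightarrow> e p > 0"
      using \<open>prime p\<close> by (metis not_prime_unit prime_multiplicity_gt_zero_iff prime_imp_prime_elem)
    then show ?thesis using e_le[OF that] False by (cases "e p = 0") auto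
  qed (use e_le[OF that] in auto)
  have "real (omega C) = (\<Sum>p\<in>P. of_bool (p dvd C))"
    unfolding C_def omega_binomial P_def N_def by simp
  then have "\<bar>real (omega C) - (\<Sum>p\<in>P. real (e p))\<bar> = \<bar>\<Sum>p\<in>P. of_bool (p dvd C) - real (e p)\<bar>"
    by (simp add: sum_subtractf)
  also have "\<dots> \<le> (\<Sum>p\<in>P. of_bool (p ^ 2 \<le> N))"
    using err by (intro order.trans[OF sum_abs] sum_mono)
  also have "\<dots> = real (card (P \<inter> {p. p ^ 2 \<le> N}))"
    by (simp add: sum.If_cases of_bool_def)
  also have "P \<inter> {p. p ^ 2 \<le> N} = {p. prime p \<and> p ^ 2 \<le> N}"
    unfolding P_def using power2_nat_le_imp_le by blast
  also have "real (card \<dots>) \<le> sqrt (real N)"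
    by (rule card_primes_square_le)
  finally show ?thesis
    using series unfolding C_def N_def by simp
qed

theorem theorem1:
  fixes m n :: nat
  assumes "m \<ge> 1" and "n \<ge> m"
  shows "(\<lambda>k::nat. real (omega ((n * k) choose (m * k))) -
            (\<Sum>j. real (primes_pi (real (n * k) / real (Suc j)))
                 - real (primes_pi (real ((n - m) * k) / real (Suc j)))
                 - real (primes_pi (real (m * k) / real (Suc j)))))
         \<in> O(\<lambda>k. sqrt (real k))"
\<comment> \<open>The bound \<open>sqrt (n * k)\<close> factors as \<open>sqrt n * sqrt k\<close>,
  which gives the constant, and it holds for every \<open>k\<close>, including 0.\<close>
proof (rule bigoI[of _ "sqrt (real n)"], rule always_eventually, rule allI)
  fix k :: nat
  have "(n - m) * k + m * k = n * k"
    using assms(2) by (simp flip: add_mult_distrib)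
  then show "norm (real (omega ((n * k) choose (m * k))) -
            (\<Sum>j. real (primes_pi (real (n * k) / real (Suc j)))
                 - real (primes_pi (real ((n - m) * k) / real (Suc j)))
                 - real (primes_pi (real (m * k) / real (Suc j)))))
         \<le> sqrt (real n) * norm (sqrt (real k))"
    using omega_binomial_bound[of "(n - m) * k" "m * k"] by (simp add: real_sqrt_mult)
qed

end
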